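(* Let $\lambda\neq0$ be a real number. The Lie algebra of Killing vector fields of $(H_3,g_1)$ contains spacelike vector fields and vector fields with changing causal character, but it contains neither timelike nor null vector fields.
   Context: The Heisenberg group $H_3$ is $\mathbb{R}^3$ with global coordinates $(x,y,z)$ and multiplication $(x,y,z)(\tilde x,\tilde y,\tilde z)=(x+\tilde x,y+\tilde y,z+\tilde z-x\tilde y)$. For $\lambda\neq0$, $g_1$ is the left-invariant Lorentzian metric $g_1=-\frac{1}{\lambda^2}dx^2+dy^2+(x\,dy+dz)^2$. A smooth vector field $X$ is Killing for $g$ if $\mathcal{L}_Xg=0$. A vector field $X$ is spacelike (resp. timelike) if $g(X,X)>0$ (resp. $g(X,X)<0$) at every point, and null if at every point $X\neq0$ and $g(X,X)=0$; it has changing causal character if its causal character (the sign of $g(X,X)$) depends on the point. *)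

theory Defs
  imports "HOL-Analysis.Analysis"
begin

primrec Ck :: "nat \<Rightarrow> ('a::euclidean_space \<Rightarrow> 'b::real_normed_vector) \<Rightarrow> bool" where
  "Ck 0 f \<longleftrightarrow> continuous_on UNIV f"
| "Ck (Suc k) f \<longleftrightarrow>
     (\<forall>p. f differentiable (at p)) \<and> (\<forall>v. Ck k (\<lambda>p. frechet_derivative f (at p) v))"

definition smooth :: "('a::euclidean_space \<Rightarrow> 'b::real_normed_vector) \<Rightarrow> bool" where
  "smooth f \<longleftrightarrow> (\<forall>k. Ck k f)"

text \<open>
  A vector field is represented by its component map with respect to the global coordinate frame,
  and a metric by the family of bilinear forms \<open>g p\<close> on the tangent space at \<open>p\<close>, which is
  identified with the ambient space by the same frame.
\<close>

type_synonym 'a vfield = "'a \<Rightarrow> 'a"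
type_synonym 'a metric = "'a \<Rightarrow> 'a \<Rightarrow> 'a \<Rightarrow> real"

definition lie_bracket :: "'a::euclidean_space vfield \<Rightarrow> 'a vfield \<Rightarrow> 'a vfield" where
  "lie_bracket X Y =
     (\<lambda>p. frechet_derivative Y (at p) (X p) - frechet_derivative X (at p) (Y p))"

text \<open>\<open>(L\<^sub>X g)(Y, Z) = X (g(Y, Z)) - g([X, Y], Z) - g(Y, [X, Z])\<close>\<close>

definition lie_derivative ::
    "'a::euclidean_space vfield \<Rightarrow> 'a metric \<Rightarrow> 'a vfield \<Rightarrow> 'a vfield \<Rightarrow> 'a \<Rightarrow> real" where
  "lie_derivative X g Y Z =
     (\<lambda>p. frechet_derivative (\<lambda>q. g q (Y q) (Z q)) (at p) (X p)
          - g p (lie_bracket X Y p) (Z p) - g p (Y p) (lie_bracket X Z p))"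

definition killing_fields :: "'a::euclidean_space metric \<Rightarrow> 'a vfield set" where
  "killing_fields g =
     {X. smooth X \<and> (\<forall>Y Z p. smooth Y \<longrightarrow> smooth Z \<longrightarrow> lie_derivative X g Y Z p = 0)}"

definition spacelike :: "'a metric \<Rightarrow> 'a vfield \<Rightarrow> bool" where
  "spacelike g X \<longleftrightarrow> (\<forall>p. g p (X p) (X p) > 0)"

definition timelike :: "'a metric \<Rightarrow> 'a vfield \<Rightarrow> bool" where
  "timelike g X \<longleftrightarrow> (\<forall>p. g p (X p) (X p) < 0)"

definition null :: "'a::zero metric \<Rightarrow> 'a vfield \<Rightarrow> bool" where
  "null g X \<longleftrightarrow> (\<forall>p. X p \<noteq> 0 \<and> g p (X p) (X p) = 0)"

definition changing_causal_character :: "'a metric \<Rightarrow> 'a vfield \<Rightarrow> bool" where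
  "changing_causal_character g X \<longleftrightarrow>
     (\<exists>p q. sgn (g p (X p) (X p)) \<noteq> sgn (g q (X q) (X q)))"

text \<open>The coordinates \<open>x, y, z\<close> of a point \<open>p\<close> are \<open>p $ 1\<close>, \<open>p $ 2\<close>, \<open>p $ 3\<close>.\<close>

definition heis_mult :: "real^3 \<Rightarrow> real^3 \<Rightarrow> real^3" where
  "heis_mult p q = vector [p$1 + q$1, p$2 + q$2, p$3 + q$3 - p$1 * q$2]"

definition g1 :: "real \<Rightarrow> (real^3) metric" where
  "g1 lam p u v =
     - (1 / lam\<^sup>2) * (u$1 * v$1) + u$2 * v$2
     + (p$1 * u$2 + u$3) * (p$1 * v$2 + v$3)"

lemma heis_mult_has_derivative:
  "(heis_mult a has_derivative (\<lambda>u. vector [u$1, u$2, u$3 - a$1 * u$2])) (at p)"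
proof -
  let ?L = "\<lambda>u::real^3. vector [u$1, u$2, u$3 - a$1 * u$2] :: real^3"
  have "linear ?L"
    by (intro linearI) (simp_all add: vec_eq_iff forall_3 algebra_simps)
  then have "((\<lambda>u. a + ?L u) has_derivative ?L) (at p)"
    by (auto simp: linear_conv_bounded_linear
        intro!: derivative_eq_intros bounded_linear_imp_has_derivative)
  moreover have "heis_mult a = (\<lambda>u. a + ?L u)"
    by (simp add: heis_mult_def fun_eq_iff vec_eq_iff forall_3)
  ultimately show ?thesis
    by simp
qed

lemma g1_left_invariant:
  "g1 lam (heis_mult a p)
      (frechet_derivative (heis_mult a) (at p) u) (frechet_derivative (heis_mult a) (at p) v)
   = g1 lam p u v"
  unfolding frechet_derivative_at[OF heis_mult_has_derivative, symmetric]
  by (simp add: g1_def heis_mult_def algebra_simps)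

end

theory Submission
  imports Defs
begin

text \<open>
  Let \<open>X = (P, Q, R)\<close> be Killing and put \<open>W = x Q + R\<close>, the value of the form \<open>x dy + dz\<close> on \<open>X\<close>.
  Then \<open>P\<close> does not depend on \<open>x\<close>, \<open>W\<close> does not depend on \<open>z\<close>, and comparing the remaining
  equations at different values of \<open>x\<close> and \<open>z\<close> shows that \<open>P = c + \<lambda>\<^sup>2 d y\<close>, \<open>Q = a + d x\<close> and
  \<open>W = b + a x + d x\<^sup>2 / 2 - c y - \<lambda>\<^sup>2 d y\<^sup>2 / 2\<close>, with no second derivatives involved.
  As \<open>g(X, X) = - P\<^sup>2 / \<lambda>\<^sup>2 + Q\<^sup>2 + W\<^sup>2\<close>, unless \<open>X = 0\<close> this is positive somewhere: on the plane
  \<open>P = 0\<close> if \<open>d \<noteq> 0\<close>, for large \<open>\<bar>y\<bar>\<close> if \<open>d = 0 \<noteq> c\<close>, and at the origin otherwise.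
\<close>

section \<open>Smoothness of constant and affine maps\<close>

lemma smooth_const:
  fixes c :: "'b::real_normed_vector"
  shows "smooth (\<lambda>_::'a::euclidean_space. c)"
proof -
  have "Ck k (\<lambda>_::'a. c)" for k and c :: 'b
    by (induction k arbitrary: c) (simp_all add: frechet_derivative_const)
  then show ?thesis
    by (simp add: smooth_def)
qed

text \<open>The derivative \<open>L\<close> is the same at every point, so each directional
  derivative of \<open>f\<close> is a constant map and \<open>smooth_const\<close> covers all higher
  orders.\<close>

lemma smooth_affine:
  assumes "\<And>p. (f has_derivative L) (at p)"
  shows "smooth f"
proof -
  have "Ck k f" for k
  proof (cases k)
    case 0
    then show ?thesis
      using assms by (auto intro!: continuous_at_imp_continuous_on has_derivative_continuous)
  next
    case (Suc m)
    then show ?thesis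
      using assms smooth_const frechet_derivative_at[OF assms, symmetric]
      by (auto simp: smooth_def differentiable_def)
  qed
  then show ?thesis
    by (simp add: smooth_def)
qed

lemma smooth_differentiable: "smooth f \<Longrightarrow> f differentiable (at p)"
  unfolding smooth_def by (metis Ck.simps(2))

section \<open>The Lie derivative of \<open>g1 lam\<close> in coordinates\<close>

lemma has_derivative_vec_nth:
  "(f has_derivative f') F \<Longrightarrow> ((\<lambda>x. f x $ i) has_derivative (\<lambda>h. f' h $ i)) F"
  by (rule bounded_linear.has_derivative[OF bounded_linear_vec_nth])

text \<open>The terms with \<open>Y'\<close> and \<open>Z'\<close> from the product rule cancel
  against those in the two brackets. What is left depends on \<open>Y\<close> and \<open>Z\<close>
  only through their values at \<open>p\<close>, so constant test fields lose nothing. The first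
  summand comes from differentiating the metric coefficients, which depend on x alone.\<close>

lemma lie_derivative_g1:
  assumes X: "(X has_derivative X') (at p)"
    and Y: "(Y has_derivative Y') (at p)" and Z: "(Z has_derivative Z') (at p)"
  shows "lie_derivative X (g1 lam) Y Z p =
    X p $ 1 * (Y p $ 2 * (p $ 1 * Z p $ 2 + Z p $ 3) + (p $ 1 * Y p $ 2 + Y p $ 3) * Z p $ 2)
    + g1 lam p (X' (Y p)) (Z p) + g1 lam p (Y p) (X' (Z p))"
proof -
  have "((\<lambda>q. g1 lam q (Y q) (Z q)) has_derivative
      (\<lambda>h. h $ 1 * (Y p $ 2 * (p $ 1 * Z p $ 2 + Z p $ 3) + (p $ 1 * Y p $ 2 + Y p $ 3) * Z p $ 2)
        + g1 lam p (Y' h) (Z p) + g1 lam p (Y p) (Z' h))) (at p)"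
    unfolding g1_def
    by (rule derivative_eq_intros has_derivative_vec_nth Y Z has_derivative_ident refl)+
      (simp add: fun_eq_iff algebra_simps)
  note fd = frechet_derivative_at[OF this, symmetric]
  show ?thesis
    unfolding lie_derivative_def lie_bracket_def fd frechet_derivative_at[OF X, symmetric]
      frechet_derivative_at[OF Y, symmetric] frechet_derivative_at[OF Z, symmetric]
    by (simp add: g1_def algebra_simps)
qed

lemma smooth_has_derivative: "smooth f \<Longrightarrow> (f has_derivative frechet_derivative f (at p)) (at p)"
  using smooth_differentiable frechet_derivative_works by blast

lemma killing_fields_g1I:
  assumes "smooth X" and "\<And>p. (X has_derivative X' p) (at p)"
    and "\<And>p u v. X p $ 1 * (u $ 2 * (p $ 1 * v $ 2 + v $ 3) + (p $ 1 * u $ 2 + u $ 3) * v $ 2)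
      + g1 lam p (X' p u) v + g1 lam p u (X' p v) = 0"
  shows "X \<in> killing_fields (g1 lam)"
  using assms unfolding killing_fields_def
  by (auto simp: lie_derivative_g1[OF assms(2) smooth_has_derivative smooth_has_derivative])

section \<open>Two explicit Killing fields\<close>

lemma constant_field_3_killing: "(\<lambda>_. axis 3 1) \<in> killing_fields (g1 lam)"
  by (rule killing_fields_g1I[where X' = "\<lambda>_ _. 0"])
    (auto simp: smooth_const g1_def axis_def)

text \<open>This field generates the flow (x, y, z) -> (x + t, y, z - t y), which is left
  translation by (t, 0, 0) and hence acts by isometries.\<close>

lemma x_translation_killing: "(\<lambda>p. vector [1, 0, - p $ 2]) \<in> killing_fields (g1 lam)"
proof -
  let ?L = "\<lambda>u::real^3. vector [0, 0, - u $ 2] :: real^3"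
  have "linear ?L"
    by (intro linearI) (simp_all add: vec_eq_iff forall_3)
  then have "((\<lambda>u. axis 1 1 + ?L u) has_derivative ?L) (at p)" for p
    by (auto simp: linear_conv_bounded_linear
        intro!: derivative_eq_intros bounded_linear_imp_has_derivative)
  moreover have "(\<lambda>u::real^3. vector [1, 0, - u $ 2]) = (\<lambda>u. axis 1 1 + ?L u)"
    by (simp add: fun_eq_iff vec_eq_iff forall_3 axis_def)
  ultimately have D: "((\<lambda>u::real^3. vector [1, 0, - u $ 2]) has_derivative ?L) (at p)" for p
    by simp
  show ?thesis
    by (rule killing_fields_g1I[OF smooth_affine[OF D] D]) (simp add: g1_def algebra_simps)
qed

section \<open>The Killing equations and their solution\<close>

lemma killing_equations_g1:
  assumes "X \<in> killing_fields (g1 lam)" and "lam \<noteq> 0"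
  defines "D \<equiv> \<lambda>p. frechet_derivative X (at p)"
  shows "D p (axis 1 1) $ 1 = 0"
    and "p $ 1 * D p (axis 1 1) $ 2 + D p (axis 1 1) $ 3 = D p (axis 3 1) $ 1 / lam\<^sup>2"
    and "p $ 1 * D p (axis 3 1) $ 2 + D p (axis 3 1) $ 3 = 0"
    and "D p (axis 2 1) $ 1 = lam\<^sup>2 * D p (axis 1 1) $ 2 + p $ 1 * D p (axis 3 1) $ 1"
    and "D p (axis 2 1) $ 2 = p $ 1 * D p (axis 3 1) $ 2"
    and "p $ 1 * D p (axis 2 1) $ 2 + D p (axis 2 1) $ 3 = - X p $ 1 - D p (axis 3 1) $ 2"
proof -
  have X: "smooth X"
    using assms by (simp add: killing_fields_def)
  have K: "X p $ 1 * (u $ 2 * (p $ 1 * v $ 2 + v $ 3) + (p $ 1 * u $ 2 + u $ 3) * v $ 2)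
      + g1 lam p (D p u) v + g1 lam p u (D p v) = 0" for u v
  proof -
    have "lie_derivative X (g1 lam) (\<lambda>_. u) (\<lambda>_. v) p = 0"
      using assms(1) smooth_const by (auto simp: killing_fields_def)
    then show ?thesis
      by (simp add: lie_derivative_g1[OF smooth_has_derivative[OF X] has_derivative_const
            has_derivative_const] D_def)
  qed
  note k = K[unfolded g1_def, of "axis i 1" "axis j 1" for i j]
  \<comment> \<open>The six component equations are arranged around W = x Q + R: the combination
    \<open>p $ 1 * D p e $ 2 + D p e $ 3\<close> is the derivative of W along \<open>e\<close>,
    except that for \<open>axis 1 1\<close> the product rule adds a further Q.\<close>
  show e1: "D p (axis 1 1) $ 1 = 0"
    using k[of 1 1] \<open>lam \<noteq> 0\<close> by (simp add: axis_def)
  show e2: "p $ 1 * D p (axis 1 1) $ 2 + D p (axis 1 1) $ 3 = D p (axis 3 1) $ 1 / lam\<^sup>2"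
    using k[of 1 3] by (simp add: axis_def)
  show e3: "p $ 1 * D p (axis 3 1) $ 2 + D p (axis 3 1) $ 3 = 0"
    using k[of 3 3] by (simp add: axis_def)
  have "- D p (axis 2 1) $ 1 / lam\<^sup>2 + D p (axis 1 1) $ 2
      + (p $ 1 * D p (axis 1 1) $ 2 + D p (axis 1 1) $ 3) * p $ 1 = 0"
    using k[of 1 2] by (simp add: axis_def)
  then show "D p (axis 2 1) $ 1 = lam\<^sup>2 * D p (axis 1 1) $ 2 + p $ 1 * D p (axis 3 1) $ 1"
    unfolding e2 using \<open>lam \<noteq> 0\<close> by (simp add: field_simps)
  show e6: "p $ 1 * D p (axis 2 1) $ 2 + D p (axis 2 1) $ 3 = - X p $ 1 - D p (axis 3 1) $ 2"
    using k[of 2 3] e3 by (simp add: axis_def)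
  have "X p $ 1 * p $ 1 + D p (axis 2 1) $ 2
      + p $ 1 * (p $ 1 * D p (axis 2 1) $ 2 + D p (axis 2 1) $ 3) = 0"
    using k[of 2 2] by (simp add: axis_def algebra_simps)
  then show "D p (axis 2 1) $ 2 = p $ 1 * D p (axis 3 1) $ 2"
    unfolding e6 by (simp add: algebra_simps)
qed

lemma killing_system_solution:
  fixes P Q W :: "real \<Rightarrow> real \<Rightarrow> real \<Rightarrow> real"
  assumes "lam \<noteq> 0"
    and Px: "\<And>x y z. ((\<lambda>t. P t y z) has_field_derivative 0) (at x)"
    and Py: "\<And>x y z. ((\<lambda>t. P x t z) has_field_derivative lam\<^sup>2 * Qx x y z + x * Pz x y z) (at y)"
    and Pz: "\<And>x y z. ((\<lambda>t. P x y t) has_field_derivative Pz x y z) (at z)"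
    and Qx: "\<And>x y z. ((\<lambda>t. Q t y z) has_field_derivative Qx x y z) (at x)"
    and Qy: "\<And>x y z. ((\<lambda>t. Q x t z) has_field_derivative x * Qz x y z) (at y)"
    and Qz: "\<And>x y z. ((\<lambda>t. Q x y t) has_field_derivative Qz x y z) (at z)"
    and Wx: "\<And>x y z. ((\<lambda>t. W t y z) has_field_derivative Q x y z + Pz x y z / lam\<^sup>2) (at x)"
    and Wy: "\<And>x y z. ((\<lambda>t. W x t z) has_field_derivative - P x y z - Qz x y z) (at y)"
    and Wz: "\<And>x y z. ((\<lambda>t. W x y t) has_field_derivative 0) (at z)"
  obtains a b c d where "\<And>x y z. P x y z = c + lam\<^sup>2 * d * y" and "\<And>x y z. Q x y z = a + d * x"
    and "\<And>x y z. W x y z = b + a * x + d * x\<^sup>2 / 2 - c * y - lam\<^sup>2 * d * y\<^sup>2 / 2"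
proof -
  have const: "f s = f 0" if "\<And>t. (f has_field_derivative 0) (at t)" for f :: "real \<Rightarrow> real" and s
    using DERIV_isconst_all[of f s 0] that by blast
  \<comment> \<open>An identity between functions of one variable passes to their first derivatives.
    This replaces every appeal to mixed second derivatives.\<close>
  have deriv_eq: "D = E" if "(f has_field_derivative D) (at s)" and "(g has_field_derivative E) (at s)"
    and "\<And>t. f t = g t" for f g :: "real \<Rightarrow> real" and D E s
  proof -
    have "f = g"
      using that(3) by blast
    then show ?thesis
      using that(1,2) DERIV_unique by blast
  qed
  have P0: "P x y z = P 0 y z" for x y z
    using const[OF Px] .
  have W0: "W x y z = W x y 0" for x y z
    using const[OF Wz] .
  have Pz0: "Pz x y z = Pz 0 y z" for x y z
    using deriv_eq[OF Pz Pz P0] .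
  \<comment> \<open>W is free of z, hence so is its x-derivative; this ties the z-dependence of Q to
    that of \<open>Pz\<close>.\<close>
  have Wx0: "Q x y z + Pz 0 y z / lam\<^sup>2 = Q x y 0 + Pz 0 y 0 / lam\<^sup>2" for x y z
    using deriv_eq[OF Wx[of y z x] Wx[of y 0 x] W0] by (simp add: Pz0[of x])
  \<comment> \<open>By \<open>Wx0\<close>, passing from height 0 to height \<open>z\<close> changes
    Q by a term free of x, which does not affect \<open>Qx\<close>.\<close>
  have Qx0: "Qx x y z = Qx x y 0" for x y z
  proof (rule deriv_eq[OF Qx])
    show "((\<lambda>t. Q t y 0 + (Pz 0 y 0 - Pz 0 y z) / lam\<^sup>2) has_field_derivative Qx x y 0) (at x)"
      using Qx[of y 0 x] by (auto intro!: derivative_eq_intros)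
    show "Q t y z = Q t y 0 + (Pz 0 y 0 - Pz 0 y z) / lam\<^sup>2" for t
      using Wx0[of t y z] by (simp add: diff_divide_distrib algebra_simps)
  qed
  \<comment> \<open>P is free of x, so its y-derivative takes the same value as at x = 0.\<close>
  have Py0: "lam\<^sup>2 * Qx x y z + x * Pz 0 y z = lam\<^sup>2 * Qx 0 y z" for x y z
    using deriv_eq[OF Py[of x z y] Py[of 0 z y] P0] by (simp add: Pz0[of x])
  \<comment> \<open>Compare \<open>Py0\<close> at x = 1 for the heights \<open>z\<close> and 0: by
    \<open>Qx0\<close> the \<open>Qx\<close> terms agree, which leaves only
    \<open>Pz\<close>.\<close>
  have Pz0': "Pz 0 y z = Pz 0 y 0" for y z
    using Py0[of 1 y z] Py0[of 1 y 0] Qx0[of 0 y z] Qx0[of 1 y z] by simp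
  have Q0: "Q x y z = Q x y 0" for x y z
    using Wx0[of x y z] Pz0'[of y z] by simp
  have Qz0: "Qz x y z = 0" for x y z
    using deriv_eq[OF Qz DERIV_const Q0] .
  have Q00: "Q x y z = Q x 0 0" for x y z
    using const[of "\<lambda>t. Q x t 0" y] Qy[of x 0] Q0[of x y z] by (simp add: Qz0)
  \<comment> \<open>The y-derivative of W is free of z, and it equals -P now that \<open>Qz\<close>
    vanishes.\<close>
  have P00: "P x y z = P 0 y 0" for x y z
    using deriv_eq[OF Wy[of 0 z y] Wy[of 0 0 y] W0] P0[of x y z] by (simp add: Qz0)
  have Pz00: "Pz x y z = 0" for x y z
    using deriv_eq[OF Pz DERIV_const P00] .
  define d where "d = Qx 0 0 0"
  \<comment> \<open>Q is now a function of x alone, and \<open>Py0\<close> with \<open>Pz\<close> =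
    0 says that its derivative does not change with x.\<close>
  have Qx00: "Qx x y z = d" for x y z
  proof -
    have "Qx x y z = Qx x 0 0"
      using deriv_eq[OF Qx Qx Q00] .
    then show ?thesis
      using Py0[of x 0 0] \<open>lam \<noteq> 0\<close> by (simp add: Pz00 d_def)
  qed
  define a where "a = Q 0 0 0"
  define c where "c = P 0 0 0"
  have Q: "Q x y z = a + d * x" for x y z
  proof -
    have "((\<lambda>t. Q t 0 0 - d * t) has_field_derivative 0) (at s)" for s
      using Qx[of 0 0 s] by (auto intro!: derivative_eq_intros simp: Qx00)
    from const[OF this, of x] show ?thesis
      using Q00[of x y z] by (simp add: a_def)
  qed
  have P: "P x y z = c + lam\<^sup>2 * d * y" for x y z
  proof -
    have "((\<lambda>t. P 0 t 0 - lam\<^sup>2 * d * t) has_field_derivative 0) (at s)" for s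
      using Py[of 0 0 s] by (auto intro!: derivative_eq_intros simp: Qx00)
    from const[OF this, of y] show ?thesis
      using P00[of x y z] by (simp add: c_def)
  qed
  have "W x y z = W 0 0 0 + a * x + d * x\<^sup>2 / 2 - c * y - lam\<^sup>2 * d * y\<^sup>2 / 2" for x y z
  proof -
    \<comment> \<open>W is integrated in the plane z = 0, first along x and then along y at x = 0;
      subtracting the expected polynomial leaves derivative 0.\<close>
    have "((\<lambda>t. W t y 0 - a * t - d * t\<^sup>2 / 2) has_field_derivative 0) (at s)" for s
      using Wx[of y 0 s] by (auto intro!: derivative_eq_intros simp: Pz00 Q)
    from const[OF this, of x] have "W x y 0 = W 0 y 0 + a * x + d * x\<^sup>2 / 2"
      by simp
    moreover have "((\<lambda>t. W 0 t 0 + c * t + lam\<^sup>2 * d * t\<^sup>2 / 2) has_field_derivative 0) (at s)" for s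
      using Wy[of 0 0 s] by (auto intro!: derivative_eq_intros simp: Qz0 P)
    from const[OF this, of y] have "W 0 y 0 = W 0 0 0 - c * y - lam\<^sup>2 * d * y\<^sup>2 / 2"
      by simp
    ultimately show ?thesis
      using W0[of x y z] by simp
  qed
  with P Q show ?thesis
    using that by blast
qed

lemma killing_fields_g1_components:
  assumes X: "X \<in> killing_fields (g1 lam)" and "lam \<noteq> 0"
  obtains a b c d where "\<And>p. X p $ 1 = c + lam\<^sup>2 * d * p $ 2" and "\<And>p. X p $ 2 = a + d * p $ 1"
    and "\<And>p. p $ 1 * X p $ 2 + X p $ 3 =
      b + a * p $ 1 + d * (p $ 1)\<^sup>2 / 2 - c * p $ 2 - lam\<^sup>2 * d * (p $ 2)\<^sup>2 / 2"
proof -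
  define D where "D p = frechet_derivative X (at p)" for p
  define V :: "real \<Rightarrow> real \<Rightarrow> real \<Rightarrow> real^3" where "V = (\<lambda>x y z. vector [x, y, z])"
  have V_nth [simp]: "V x y z $ 1 = x" "V x y z $ 2 = y" "V x y z $ 3 = z" for x y z
    by (simp_all add: V_def)
  have V_eta: "V (p $ 1) (p $ 2) (p $ 3) = p" for p
    by (simp add: vec_eq_iff forall_3)
  \<comment> \<open>Restricting \<open>X\<close> to a line in direction \<open>e\<close> turns its
    total derivative into the one-variable derivatives that the system is stated with.\<close>
  have line: "((\<lambda>t. X (q + t *\<^sub>R e) $ i) has_field_derivative D (q + s *\<^sub>R e) e $ i) (at s)"
    for q e i s
  proof -
    have DX: "(X has_derivative D (q + s *\<^sub>R e)) (at (q + s *\<^sub>R e))"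
      using X by (simp add: D_def killing_fields_def smooth_has_derivative)
    have "((\<lambda>t. q + t *\<^sub>R e) has_derivative (\<lambda>t. t *\<^sub>R e)) (at s)"
      by (auto intro!: derivative_eq_intros)
    from has_derivative_vec_nth[OF has_derivative_compose[OF this DX], of i] show ?thesis
      unfolding has_field_derivative_def
      by (rule has_derivative_eq_rhs)
        (simp add: fun_eq_iff linear_cmul[OF has_derivative_linear[OF DX]])
  qed
  have V_line: "V t y z = V 0 y z + t *\<^sub>R axis 1 1" "V x t z = V x 0 z + t *\<^sub>R axis 2 1"
      "V x y t = V x y 0 + t *\<^sub>R axis 3 1" for x y z t
    by (simp_all add: vec_eq_iff forall_3 axis_def)
  have d1: "((\<lambda>t. X (V t y z) $ i) has_field_derivative D (V x y z) (axis 1 1) $ i) (at x)"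
    for x y z i
    using line[of "V 0 y z" "axis 1 1" i x] by (simp flip: V_line)
  have d2: "((\<lambda>t. X (V x t z) $ i) has_field_derivative D (V x y z) (axis 2 1) $ i) (at y)"
    for x y z i
    using line[of "V x 0 z" "axis 2 1" i y] by (simp flip: V_line)
  have d3: "((\<lambda>t. X (V x y t) $ i) has_field_derivative D (V x y z) (axis 3 1) $ i) (at z)"
    for x y z i
    using line[of "V x y 0" "axis 3 1" i z] by (simp flip: V_line)
  note E = killing_equations_g1[OF assms, folded D_def, of "V x y z" for x y z,
      unfolded V_nth]
  show ?thesis
  proof (rule killing_system_solution[OF \<open>lam \<noteq> 0\<close>,
        where P = "\<lambda>x y z. X (V x y z) $ 1" and Q = "\<lambda>x y z. X (V x y z) $ 2"
          and W = "\<lambda>x y z. x * X (V x y z) $ 2 + X (V x y z) $ 3"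
          and Pz = "\<lambda>x y z. D (V x y z) (axis 3 1) $ 1"
          and Qx = "\<lambda>x y z. D (V x y z) (axis 1 1) $ 2"
          and Qz = "\<lambda>x y z. D (V x y z) (axis 3 1) $ 2"])
    fix x y z
    show "((\<lambda>t. X (V t y z) $ 1) has_field_derivative 0) (at x)"
      using d1[of y z 1 x] by (simp add: E(1))
    show "((\<lambda>t. X (V x t z) $ 1) has_field_derivative
        lam\<^sup>2 * D (V x y z) (axis 1 1) $ 2 + x * D (V x y z) (axis 3 1) $ 1) (at y)"
      using d2[of x z 1 y] by (simp add: E(4))
    show "((\<lambda>t. X (V x t z) $ 2) has_field_derivative x * D (V x y z) (axis 3 1) $ 2) (at y)"
      using d2[of x z 2 y] by (simp add: E(5))
    show "((\<lambda>t. t * X (V t y z) $ 2 + X (V t y z) $ 3) has_field_derivative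
        X (V x y z) $ 2 + D (V x y z) (axis 3 1) $ 1 / lam\<^sup>2) (at x)"
      using E(2)[of x y z] by (auto intro!: derivative_eq_intros d1 simp: mult.commute)
    show "((\<lambda>t. x * X (V x t z) $ 2 + X (V x t z) $ 3) has_field_derivative
        - X (V x y z) $ 1 - D (V x y z) (axis 3 1) $ 2) (at y)"
      using E(6)[of x y z] by (auto intro!: derivative_eq_intros d2 simp: mult.commute)
    show "((\<lambda>t. x * X (V x y t) $ 2 + X (V x y t) $ 3) has_field_derivative 0) (at z)"
      using E(3)[of x y z] by (auto intro!: derivative_eq_intros d3 simp: mult.commute)
  next
    fix a b c d
    assume "\<And>x y z. X (V x y z) $ 1 = c + lam\<^sup>2 * d * y"
      and "\<And>x y z. X (V x y z) $ 2 = a + d * x"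
      and "\<And>x y z. x * X (V x y z) $ 2 + X (V x y z) $ 3 =
        b + a * x + d * x\<^sup>2 / 2 - c * y - lam\<^sup>2 * d * y\<^sup>2 / 2"
    then show ?thesis
      using that[of c d a b] V_eta by metis
  qed (rule d1 d3)+
qed

section \<open>The sign of g(X, X) on Killing fields\<close>

lemma killing_field_g1_zero_or_positive:
  assumes X: "X \<in> killing_fields (g1 lam)" and "lam \<noteq> 0"
  shows "X 0 = 0 \<or> (\<exists>p. g1 lam p (X p) (X p) > 0)"
proof -
  obtain a b c d where P: "\<And>p. X p $ 1 = c + lam\<^sup>2 * d * p $ 2"
    and Q: "\<And>p. X p $ 2 = a + d * p $ 1"
    and W: "\<And>p. p $ 1 * X p $ 2 + X p $ 3 =
      b + a * p $ 1 + d * (p $ 1)\<^sup>2 / 2 - c * p $ 2 - lam\<^sup>2 * d * (p $ 2)\<^sup>2 / 2"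
    by (rule killing_fields_g1_components[OF assms]) (rule that, assumption+)
  have g: "g1 lam p (X p) (X p) =
      - (X p $ 1 / lam)\<^sup>2 + (X p $ 2)\<^sup>2 + (p $ 1 * X p $ 2 + X p $ 3)\<^sup>2" for p
    by (simp add: g1_def power2_eq_square)
  consider "d \<noteq> 0" | "d = 0" "c \<noteq> 0" | "d = 0" "c = 0" "a \<noteq> 0" | "d = 0" "c = 0" "a = 0"
    by blast
  then show ?thesis
  proof cases
    case 1
    \<comment> \<open>The y-coordinate makes P vanish and the x-coordinate makes Q equal to 1, so
      g(X, X) is at least 1 whatever W is.\<close>
    let ?p = "vector [(1 - a) / d, - c / (lam\<^sup>2 * d), 0] :: real^3"
    have "X ?p $ 1 = 0" "X ?p $ 2 = 1"
      using 1 \<open>lam \<noteq> 0\<close> by (simp_all add: P Q)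
    then have "g1 lam ?p (X ?p) (X ?p) > 0"
      unfolding g by (simp add: add_pos_nonneg)
    then show ?thesis
      by blast
  next
    case 2
    \<comment> \<open>At x = 0 with d = 0, W is b - c y; this y solves b - c y = 1 + |c / lam|, so
      that the square of W outweighs the negative term.\<close>
    let ?p = "vector [0, (b - 1 - \<bar>c / lam\<bar>) / c, 0] :: real^3"
    have "?p $ 1 * X ?p $ 2 + X ?p $ 3 = 1 + \<bar>c / lam\<bar>"
      unfolding W using 2 by simp
    moreover have "X ?p $ 1 = c"
      using 2 by (simp add: P)
    moreover have "\<bar>c / lam\<bar>\<^sup>2 < (1 + \<bar>c / lam\<bar>)\<^sup>2"
      by (intro power_strict_mono) simp_all
    then have "(c / lam)\<^sup>2 < (1 + \<bar>c / lam\<bar>)\<^sup>2"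
      by (simp only: power2_abs)
    ultimately have "g1 lam ?p (X ?p) (X ?p) > 0"
      unfolding g using zero_le_power2[of "X ?p $ 2"] by (simp only:)
    then show ?thesis
      by blast
  next
    case 3
    then have "g1 lam 0 (X 0) (X 0) > 0"
      unfolding g by (simp add: P Q add_pos_nonneg)
    then show ?thesis
      by blast
  next
    case 4
    show ?thesis
    proof (cases "b = 0")
      case True
      then have "X 0 = 0"
        using P[of 0] Q[of 0] W[of 0] 4 by (simp add: vec_eq_iff forall_3)
      then show ?thesis
      by blast
    next
      case False
      then have "g1 lam 0 (X 0) (X 0) > 0"
        unfolding g W using 4 by (simp add: P Q)
      then show ?thesis
        by blast
    qed
  qed
qed

theorem proposition3p3:
  fixes lam :: real
  assumes "lam \<noteq> 0"
  shows "(\<exists>X \<in> killing_fields (g1 lam). spacelike (g1 lam) X)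
       \<and> (\<exists>X \<in> killing_fields (g1 lam). changing_causal_character (g1 lam) X)
       \<and> \<not> (\<exists>X \<in> killing_fields (g1 lam). timelike (g1 lam) X)
       \<and> \<not> (\<exists>X \<in> killing_fields (g1 lam). null (g1 lam) X)"
proof (intro conjI notI)
  have "spacelike (g1 lam) (\<lambda>_. axis 3 1)"
    by (simp add: spacelike_def g1_def axis_def)
  then show "\<exists>X \<in> killing_fields (g1 lam). spacelike (g1 lam) X"
    using constant_field_3_killing by blast
next
  let ?X = "\<lambda>p::real^3. vector [1, 0, - p $ 2] :: real^3"
  \<comment> \<open>Here g(X, X) = y^2 - 1 / lam^2, which is negative at the origin and zero at y =
    1 / lam; these two signs already differ.\<close>
  have "g1 lam 0 (?X 0) (?X 0) < 0"
    using assms by (simp add: g1_def)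
  moreover have "g1 lam (axis 2 (1 / lam)) (?X (axis 2 (1 / lam))) (?X (axis 2 (1 / lam))) = 0"
    by (simp add: g1_def axis_def power2_eq_square)
  ultimately have "changing_causal_character (g1 lam) ?X"
    unfolding changing_causal_character_def by (metis less_irrefl sgn_0 sgn_0_0)
  then show "\<exists>X \<in> killing_fields (g1 lam). changing_causal_character (g1 lam) X"
    using x_translation_killing by blast
next
  assume "\<exists>X \<in> killing_fields (g1 lam). timelike (g1 lam) X"
  then obtain X where X: "X \<in> killing_fields (g1 lam)" and "\<And>p. g1 lam p (X p) (X p) < 0"
    by (auto simp: timelike_def)
  \<comment> \<open>This settles the alternative \<open>X 0 = 0\<close>: the value at the origin
    would be 0 rather than negative.\<close>
  moreover have "g1 lam 0 0 0 = 0"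
    by (simp add: g1_def)
  ultimately show False
    using killing_field_g1_zero_or_positive[OF X assms] by (metis less_asym)
next
  assume "\<exists>X \<in> killing_fields (g1 lam). null (g1 lam) X"
  then show False
    using killing_field_g1_zero_or_positive[OF _ assms] by (force simp: null_def)
qed

end
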